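(* Let $r,d,p\in\mathbb{N}$, let $f:\mathbb{R}^n\to\mathbb{R}^n$ be a polynomial vector field of degree at most $d_f$, let $g_i$ be real polynomials in $x\in\mathbb{R}^n$ of degree at most $d_i$ (finitely many $i$), and define $\Omega:=\{x\in\mathbb{R}^n\mid g_i(x)\ge0\ \forall i\}$. If $V$ (a polynomial, together with $k$ and $\gamma$) solves the optimization problem $$\begin{aligned}\max_{k\ge0,\ \gamma>0,\ V}\quad & k\\ \text{s.t.}\quad & V(x)-(x^Tx)^{r/2}\in\Sigma_{s,2d}[\Omega],\\ & \gamma(x^Tx)^{r/2}-V(x)\in\Sigma_{s,2d}[\Omega],\\ & -\tfrac{kr}{p}V(x)(x^Tx)^{p/2}-\nabla V(x)^Tf(x)\in\Sigma_{s,d'}[\Omega],\end{aligned}$$ where $d'=\max\{2d+p,2d-1+d_f\}$, then for any $c\in\mathbb{R}_+$ such that $S_c(V)\subseteq\mathrm{int}(\Omega)$, $f$ is rationally stable on $S_c(V)$ (with exponent $p$) with rate $k$ and gain $M:=\gamma^{\frac pr}$.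
   Context: $\mathbb{R}_+=[0,\infty)$. $S_c(V):=\{x\in\mathbb{R}^n\mid V(x)\le c\}$. $\Sigma_{s,d}$ denotes sum-of-squares polynomials of degree at most $d$: for even $d$, $p\in\Sigma_{s,d}$ means $p(x)=Z_{d/2}(x)^TPZ_{d/2}(x)$ for some positive semidefinite matrix $P$, where $Z_{d/2}$ is the vector of monomials of degree $d/2$ or less. For $\Omega=\{x\mid g_i(x)\ge0\ \forall i\}$ with $g_i$ of degree at most $d_i$, $p\in\Sigma_{s,d}[\Omega]$ means $p(x)=s_0(x)+\sum_is_i(x)g_i(x)$ for some $s_0\in\Sigma_{s,d}$ and $s_i\in\Sigma_{s,d-d_i}$ (with $s_i=0$ if $d-d_i<0$). For a vector field $f$, $\phi_f$ denotes the solution map: $\partial_t\phi_f(x,t)=f(\phi_f(x,t))$, $\phi_f(x,0)=x$, assumed throughout well-defined, unique and jointly continuous. For given $p\in\mathbb{N}$, $f$ is rationally stable on a set $G$ with rate $k\ge0$ and gain $M\ge1$ if $\|\phi_f(x,t)\|_2^p\le M\dfrac{\|x\|_2^p}{1+\|x\|_2^pkt}$ for all $x\in G$, $t\ge0$. *)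

theory Defs
  imports "HOL-Analysis.Analysis"
begin

text \<open>
  Real polynomials in the coordinates of \<open>x :: real ^ 'n\<close> are represented by the functions they
  induce. A multi-index is a function \<open>'n \<Rightarrow> nat\<close>.
\<close>

definition multi_indices :: "nat \<Rightarrow> ('n::finite \<Rightarrow> nat) set" where
  "multi_indices m = {\<alpha>. (\<Sum>i\<in>UNIV. \<alpha> i) \<le> m}"

definition monomial :: "('n::finite \<Rightarrow> nat) \<Rightarrow> real ^ 'n \<Rightarrow> real" where
  "monomial \<alpha> x = (\<Prod>i\<in>UNIV. (x $ i) ^ \<alpha> i)"

definition poly_degree_le :: "nat \<Rightarrow> (real ^ 'n::finite \<Rightarrow> real) \<Rightarrow> bool" where
  "poly_degree_le m q \<longleftrightarrow>
     (\<exists>c. \<forall>x. q x = (\<Sum>\<alpha>\<in>multi_indices m. c \<alpha> * monomial \<alpha> x))"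

definition positive_semidefinite_on :: "'a set \<Rightarrow> ('a \<Rightarrow> 'a \<Rightarrow> real) \<Rightarrow> bool" where
  "positive_semidefinite_on A P \<longleftrightarrow>
     (\<forall>\<alpha>\<in>A. \<forall>\<beta>\<in>A. P \<alpha> \<beta> = P \<beta> \<alpha>) \<and>
     (\<forall>v. (\<Sum>\<alpha>\<in>A. \<Sum>\<beta>\<in>A. v \<alpha> * P \<alpha> \<beta> * v \<beta>) \<ge> 0)"

text \<open>
  \<open>sos_polys d\<close> is the set of polynomials \<open>Z(x)\<^sup>T P Z(x)\<close>, with \<open>Z\<close> the vector of monomials of
  degree at most \<open>d/2\<close>. For odd \<open>d\<close> the rounding in \<open>d div 2\<close> is the right one: a sum of squares
  of degree at most \<open>d\<close> has even degree, hence degree at most \<open>d - 1\<close>.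
\<close>

definition sos_polys :: "nat \<Rightarrow> (real ^ 'n::finite \<Rightarrow> real) set" where
  "sos_polys d =
     {q. \<exists>P. positive_semidefinite_on (multi_indices (d div 2)) P \<and>
             (\<forall>x. q x = (\<Sum>\<alpha>\<in>multi_indices (d div 2). \<Sum>\<beta>\<in>multi_indices (d div 2).
                           monomial \<alpha> x * P \<alpha> \<beta> * monomial \<beta> x))}"

definition semialgebraic_set :: "nat \<Rightarrow> (nat \<Rightarrow> real ^ 'n \<Rightarrow> real) \<Rightarrow> (real ^ 'n) set" where
  "semialgebraic_set m g = {x. \<forall>i<m. g i x \<ge> 0}"

text \<open>
  The set \<open>\<Sigma>\<^sub>s\<^sub>,\<^sub>d[\<Omega>]\<close> depends on the description of \<open>\<Omega>\<close> by the polynomials \<open>g i\<close>, \<open>i < m\<close>, and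
  their degree bounds \<open>dg i\<close>, not only on \<open>\<Omega>\<close> as a set.
\<close>

definition sos_polys_on ::
  "nat \<Rightarrow> (nat \<Rightarrow> real ^ 'n::finite \<Rightarrow> real) \<Rightarrow> (nat \<Rightarrow> nat) \<Rightarrow> nat \<Rightarrow> (real ^ 'n \<Rightarrow> real) set" where
  "sos_polys_on m g dg d =
     {q. \<exists>s0 s. s0 \<in> sos_polys d \<and>
           (\<forall>i<m. if dg i \<le> d then s i \<in> sos_polys (d - dg i) else s i = (\<lambda>x. 0)) \<and>
           (\<forall>x. q x = s0 x + (\<Sum>i<m. s i x * g i x))}"

definition gradient :: "(real ^ 'n::finite \<Rightarrow> real) \<Rightarrow> real ^ 'n \<Rightarrow> real ^ 'n" where
  "gradient V x = (\<chi> i. frechet_derivative V (at x) (axis i 1))"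

text \<open>
  Feasibility of \<open>(k, \<gamma>, V)\<close>. Since \<open>r > 0\<close> and \<open>p > 0\<close> in all uses, \<open>powr\<close> gives the intended
  value \<open>0\<close> of \<open>(x\<^sup>T x)\<^sup>r\<^sup>/\<^sup>2\<close> at \<open>x = 0\<close>. The number \<open>2d - 1 + d\<^sub>f\<close> is written \<open>2 * d + df - 1\<close>; the
  subtraction truncates only for \<open>d = df = 0\<close>, where the maximum is \<open>p\<close> in any case.
\<close>

definition feasible ::
  "nat \<Rightarrow> nat \<Rightarrow> nat \<Rightarrow> nat \<Rightarrow> (real ^ 'n::finite \<Rightarrow> real ^ 'n) \<Rightarrow>
   nat \<Rightarrow> (nat \<Rightarrow> real ^ 'n \<Rightarrow> real) \<Rightarrow> (nat \<Rightarrow> nat) \<Rightarrow>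
   real \<times> real \<times> (real ^ 'n \<Rightarrow> real) \<Rightarrow> bool" where
  "feasible r d p df f m g dg = (\<lambda>(k, \<gamma>, V).
     k \<ge> 0 \<and> \<gamma> > 0 \<and> real_polynomial_function V \<and>
     (\<lambda>x. V x - (x \<bullet> x) powr (real r / 2)) \<in> sos_polys_on m g dg (2 * d) \<and>
     (\<lambda>x. \<gamma> * (x \<bullet> x) powr (real r / 2) - V x) \<in> sos_polys_on m g dg (2 * d) \<and>
     (\<lambda>x. - (k * real r / real p) * V x * (x \<bullet> x) powr (real p / 2) - gradient V x \<bullet> f x)
       \<in> sos_polys_on m g dg (max (2 * d + p) (2 * d + df - 1)))"

definition solves_optimization ::
  "nat \<Rightarrow> nat \<Rightarrow> nat \<Rightarrow> nat \<Rightarrow> (real ^ 'n::finite \<Rightarrow> real ^ 'n) \<Rightarrow>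
   nat \<Rightarrow> (nat \<Rightarrow> real ^ 'n \<Rightarrow> real) \<Rightarrow> (nat \<Rightarrow> nat) \<Rightarrow>
   real \<Rightarrow> real \<Rightarrow> (real ^ 'n \<Rightarrow> real) \<Rightarrow> bool" where
  "solves_optimization r d p df f m g dg k \<gamma> V \<longleftrightarrow>
     is_arg_max (\<lambda>(k, \<gamma>, V). k) (feasible r d p df f m g dg) (k, \<gamma>, V)"

text \<open>
  The solution map is a forward semiflow on all of \<open>\<real>\<^sup>n\<close>: existence, uniqueness and joint
  continuity are required for \<open>t \<ge> 0\<close> only (the derivative at \<open>t = 0\<close> is one-sided).
\<close>

definition solves_ivp ::
  "(real ^ 'n::finite \<Rightarrow> real ^ 'n) \<Rightarrow> real ^ 'n \<Rightarrow> (real \<Rightarrow> real ^ 'n) \<Rightarrow> bool" where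
  "solves_ivp f x y \<longleftrightarrow>
     y 0 = x \<and> (\<forall>t\<ge>0. (y has_vector_derivative f (y t)) (at t within {0..}))"

definition is_solution_map ::
  "(real ^ 'n::finite \<Rightarrow> real ^ 'n) \<Rightarrow> (real ^ 'n \<Rightarrow> real \<Rightarrow> real ^ 'n) \<Rightarrow> bool" where
  "is_solution_map f \<phi> \<longleftrightarrow>
     (\<forall>x. solves_ivp f x (\<phi> x)) \<and>
     (\<forall>x y. solves_ivp f x y \<longrightarrow> (\<forall>t\<ge>0. y t = \<phi> x t)) \<and>
     continuous_on (UNIV \<times> {0..}) (\<lambda>(x, t). \<phi> x t)"

definition rationally_stable ::
  "nat \<Rightarrow> (real ^ 'n::finite \<Rightarrow> real \<Rightarrow> real ^ 'n) \<Rightarrow> (real ^ 'n) set \<Rightarrow> real \<Rightarrow> real \<Rightarrow> bool" where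
  "rationally_stable p \<phi> G k M \<longleftrightarrow>
     k \<ge> 0 \<and> M \<ge> 1 \<and>
     (\<forall>x\<in>G. \<forall>t\<ge>0. norm (\<phi> x t) ^ p \<le> M * (norm x ^ p / (1 + norm x ^ p * k * t)))"

definition sublevel_set :: "(real ^ 'n \<Rightarrow> real) \<Rightarrow> real \<Rightarrow> (real ^ 'n) set" where
  "sublevel_set V c = {x. V x \<le> c}"

end

theory Submission
  imports Defs
begin

text \<open>
  The function \<open>V\<close> is a Lyapunov function whose decay is polynomial rather than exponential.
  Membership in \<open>\<Sigma>\<^sub>s[\<Omega>]\<close> certifies nonnegativity on \<open>\<Omega>\<close>, so on \<open>\<Omega>\<close> the three constraints read
  \<open>\<bar>x\<bar>\<^sup>r \<le> V x\<close>, \<open>V x \<le> \<gamma> \<bar>x\<bar>\<^sup>r\<close> and \<open>\<nabla>V x \<bullet> f x \<le> - (k r / p) V x \<bar>x\<bar>\<^sup>p\<close>. The sublevel set lies in the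
  interior of \<open>\<Omega>\<close>, and \<open>V\<close> cannot increase along a solution while this stays in \<open>\<Omega>\<close>; hence
  solutions never leave the sublevel set (\<open>sublevel_set_invariant\<close>). With \<open>a = p / r\<close>, the upper
  bound on \<open>V\<close> turns the third inequality into \<open>W' \<le> - (b / a) W\<^sup>1\<^sup>+\<^sup>a\<close> for
  \<open>W t = V (y t)\<close> and \<open>b = k / \<gamma>\<^sup>a\<close>. This says that \<open>W\<^sup>-\<^sup>a\<close> grows at least at rate \<open>b\<close>
  (\<open>rational_decay\<close>), and returning from \<open>W\<close> to norms by the two bounds on \<open>V\<close> gives the
  estimate with gain \<open>\<gamma>\<^sup>a\<close> (\<open>lyapunov_rational_stability\<close>).

  Rational stability also requires the gain to be at least \<open>1\<close>. At any nonzero point of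
  \<open>\<Omega>\<close> the bounds on \<open>V\<close> force \<open>\<gamma> \<ge> 1\<close>, but \<open>\<Omega>\<close> may be empty or \<open>{0}\<close>. Here the maximality of \<open>k\<close>
  enters (\<open>solves_optimization_gain_ge_1\<close>): if \<open>\<gamma> < 1\<close>, adding the first two constraints gives
  \<open>- \<bar>x\<bar>\<^sup>r \<in> \<Sigma>\<^sub>s\<^sub>,\<^sub>2\<^sub>d[\<Omega>]\<close>. So \<open>\<bar>x\<bar>\<^sup>r\<close> is a polynomial of degree at most \<open>2 d\<close>, which makes \<open>r\<close> even
  and \<open>\<bar>x\<bar>\<^sup>r\<close> a sum of squares. Then the zero function is feasible with every rate \<open>k\<close>, and no
  maximum exists.
\<close>

section \<open>Polynomials of bounded degree\<close>

lemma finite_multi_indices: "finite (multi_indices e :: ('n::finite \<Rightarrow> nat) set)"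
proof (rule finite_subset)
  show "(multi_indices e :: ('n \<Rightarrow> nat) set) \<subseteq> PiE UNIV (\<lambda>_. {..e})"
  proof
    fix \<alpha> :: "'n \<Rightarrow> nat"
    assume "\<alpha> \<in> multi_indices e"
    then have "\<alpha> i \<le> e" for i
      using member_le_sum[of i UNIV \<alpha>] by (auto simp: multi_indices_def)
    then show "\<alpha> \<in> PiE UNIV (\<lambda>_. {..e})" by auto
  qed
qed (simp add: finite_PiE)

lemma poly_degree_le_add:
  assumes "poly_degree_le e q1" and "poly_degree_le e q2"
  shows "poly_degree_le e (\<lambda>x. q1 x + q2 x)"
proof -
  from assms obtain c1 c2
    where "\<forall>x. q1 x = (\<Sum>\<alpha>\<in>multi_indices e. c1 \<alpha> * monomial \<alpha> x)"
      and "\<forall>x. q2 x = (\<Sum>\<alpha>\<in>multi_indices e. c2 \<alpha> * monomial \<alpha> x)"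
    unfolding poly_degree_le_def by blast
  then show ?thesis
    unfolding poly_degree_le_def
    by (intro exI[of _ "\<lambda>\<alpha>. c1 \<alpha> + c2 \<alpha>"]) (simp add: sum.distrib distrib_right)
qed

lemma poly_degree_le_cmult:
  assumes "poly_degree_le e q"
  shows "poly_degree_le e (\<lambda>x. a * q x)"
proof -
  from assms obtain c where "\<forall>x. q x = (\<Sum>\<alpha>\<in>multi_indices e. c \<alpha> * monomial \<alpha> x)"
    unfolding poly_degree_le_def by blast
  then show ?thesis
    unfolding poly_degree_le_def
    by (intro exI[of _ "\<lambda>\<alpha>. a * c \<alpha>"]) (simp add: sum_distrib_left mult.assoc)
qed

lemma poly_degree_le_zero: "poly_degree_le e (\<lambda>x. 0)"
  unfolding poly_degree_le_def by (intro exI[of _ "\<lambda>_. 0"]) simp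

lemma poly_degree_le_sum:
  assumes "\<And>i. i \<in> I \<Longrightarrow> poly_degree_le e (q i)"
  shows "poly_degree_le e (\<lambda>x. \<Sum>i\<in>I. q i x)"
  using assms
  by (induction I rule: infinite_finite_induct)
     (auto intro: poly_degree_le_zero poly_degree_le_add)

lemma poly_degree_le_monomial:
  assumes "\<alpha> \<in> multi_indices e"
  shows "poly_degree_le e (monomial \<alpha>)"
  unfolding poly_degree_le_def
proof (intro exI allI)
  fix x
  have "(\<Sum>\<beta>\<in>multi_indices e. (if \<beta> = \<alpha> then 1 else 0) * monomial \<beta> x)
      = (\<Sum>\<beta>\<in>multi_indices e. if \<beta> = \<alpha> then monomial \<beta> x else 0)"
    by (intro sum.cong) auto
  also have "\<dots> = monomial \<alpha> x"
    using assms by (simp add: finite_multi_indices)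
  finally show "monomial \<alpha> x = (\<Sum>\<beta>\<in>multi_indices e. (if \<beta> = \<alpha> then 1 else 0) * monomial \<beta> x)"
    by simp
qed

lemma poly_degree_le_mono:
  assumes "poly_degree_le e q" and "e \<le> e'"
  shows "poly_degree_le e' q"
proof -
  obtain c where q: "q = (\<lambda>x. \<Sum>\<alpha>\<in>multi_indices e. c \<alpha> * monomial \<alpha> x)"
    using assms(1) unfolding poly_degree_le_def by blast
  show ?thesis
    unfolding q using assms(2)
    by (intro poly_degree_le_sum poly_degree_le_cmult poly_degree_le_monomial)
       (auto simp: multi_indices_def)
qed

lemma monomial_mult: "monomial \<alpha> x * monomial \<beta> x = monomial (\<lambda>i. \<alpha> i + \<beta> i) x"
  by (simp add: monomial_def power_add prod.distrib)

lemma poly_degree_le_mult: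
  assumes "poly_degree_le e1 q1" and "poly_degree_le e2 q2"
  shows "poly_degree_le (e1 + e2) (\<lambda>x. q1 x * q2 x)"
proof -
  from assms obtain c1 c2
    where q: "q1 = (\<lambda>x. \<Sum>\<alpha>\<in>multi_indices e1. c1 \<alpha> * monomial \<alpha> x)"
             "q2 = (\<lambda>x. \<Sum>\<alpha>\<in>multi_indices e2. c2 \<alpha> * monomial \<alpha> x)"
    unfolding poly_degree_le_def by blast
  have "(\<lambda>x. q1 x * q2 x) =
      (\<lambda>x. \<Sum>\<alpha>\<in>multi_indices e1. \<Sum>\<beta>\<in>multi_indices e2.
            (c1 \<alpha> * c2 \<beta>) * monomial (\<lambda>i. \<alpha> i + \<beta> i) x)"
    by (simp add: q sum_product monomial_mult[symmetric] mult_ac)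
  moreover have "poly_degree_le (e1 + e2) \<dots>"
    by (intro poly_degree_le_sum poly_degree_le_cmult poly_degree_le_monomial)
       (auto simp: multi_indices_def sum.distrib intro: add_mono)
  ultimately show ?thesis by (simp only:)
qed

lemma poly_degree_le_one: "poly_degree_le e (\<lambda>x :: real ^ 'n::finite. 1)"
proof -
  have "monomial (\<lambda>i. 0) = (\<lambda>x :: real ^ 'n. 1)" by (simp add: monomial_def fun_eq_iff)
  then show ?thesis
    using poly_degree_le_monomial[of "\<lambda>i :: 'n. 0" e] by (simp add: multi_indices_def)
qed

lemma poly_degree_le_power:
  assumes "poly_degree_le e q"
  shows "poly_degree_le (e * j) (\<lambda>x. q x ^ j)"
proof (induction j)
  case 0
  show ?case using poly_degree_le_one by simp
next
  case (Suc j)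
  then show ?case using poly_degree_le_mult[OF assms Suc] by simp
qed

lemma poly_degree_le_coordinate: "poly_degree_le 1 (\<lambda>x :: real ^ 'n::finite. x $ i)"
proof -
  have "monomial (\<lambda>j. if j = i then 1 else 0) x = x $ i" for x :: "real ^ 'n"
  proof -
    have "monomial (\<lambda>j. if j = i then 1 else 0) x = (\<Prod>j\<in>UNIV. if j = i then x $ j else 1)"
      unfolding monomial_def by (intro prod.cong) auto
    then show ?thesis by simp
  qed
  then have "(\<lambda>x :: real ^ 'n. x $ i) = monomial (\<lambda>j. if j = i then 1 else 0)"
    by auto
  then show ?thesis
    using poly_degree_le_monomial[of "\<lambda>j. if j = i then 1 else 0" 1] by (simp add: multi_indices_def)
qed

lemma inner_self_vec: "x \<bullet> x = (\<Sum>i\<in>UNIV. (x $ i) ^ 2)" for x :: "real ^ 'n"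
  by (simp add: inner_vec_def power2_eq_square)

lemma poly_degree_le_inner_self: "poly_degree_le 2 (\<lambda>x :: real ^ 'n::finite. x \<bullet> x)"
  unfolding inner_self_vec
  using poly_degree_le_power[OF poly_degree_le_coordinate, of 2] by (intro poly_degree_le_sum) simp

lemma monomial_scaleR: "monomial \<alpha> (t *\<^sub>R u) = t ^ (\<Sum>i\<in>UNIV. \<alpha> i) * monomial \<alpha> u"
  by (simp add: monomial_def power_mult_distrib prod.distrib power_sum)

text \<open>
  Restriction to a line through the origin reduces questions on degrees to univariate
  polynomials, where finitely many roots determine equality.
\<close>

lemma poly_degree_le_line:
  assumes "poly_degree_le e q"
  obtains P :: "real poly" where "degree P \<le> e" and "\<And>t. poly P t = q (t *\<^sub>R u)"
proof -
  obtain c where q: "\<And>x. q x = (\<Sum>\<alpha>\<in>multi_indices e. c \<alpha> * monomial \<alpha> x)"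
    using assms unfolding poly_degree_le_def by blast
  let ?P = "\<Sum>\<alpha>\<in>multi_indices e. monom (c \<alpha> * monomial \<alpha> u) (\<Sum>i\<in>UNIV. \<alpha> i)"
  have "degree ?P \<le> e"
    by (rule degree_sum_le[OF finite_multi_indices])
       (auto simp: multi_indices_def intro: order.trans[OF degree_monom_le])
  moreover have "poly ?P t = q (t *\<^sub>R u)" for t
    by (simp add: q poly_sum poly_monom monomial_scaleR mult_ac)
  ultimately show ?thesis using that by blast
qed

text \<open>
  On a line spanned by a unit vector, the norm power is \<open>\<bar>t\<bar>\<^sup>r\<close>. A polynomial that agrees with it for
  \<open>t > 0\<close> is \<open>t\<^sup>r\<close>, whose degree is \<open>r\<close> and whose value at \<open>-1\<close> is \<open>1\<close> for even \<open>r\<close> only.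
\<close>

lemma norm_power_polynomial_imp:
  assumes "poly_degree_le e (\<lambda>x :: real ^ 'n::finite. norm x ^ r)"
  shows "even r \<and> r \<le> e"
proof -
  define u :: "real ^ 'n" where "u = axis undefined 1"
  have nu: "norm u = 1" by (simp add: u_def)
  obtain P where P: "degree P \<le> e" "\<And>t. poly P t = norm (t *\<^sub>R u) ^ r"
    using poly_degree_le_line[OF assms] by blast
  have P': "poly P t = \<bar>t\<bar> ^ r" for t using P(2) nu by simp
  have "{0<..} \<subseteq> {t. poly (P - monom 1 r) t = 0}"
    by (auto simp: P' poly_monom)
  then have "infinite {t. poly (P - monom 1 r) t = 0}"
    using finite_subset infinite_Ioi[of "0::real"] by blast
  then have "P - monom 1 r = 0"
    using poly_roots_finite by blast
  then have eq: "P = monom 1 r" by simp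
  have "r \<le> e" using P(1) by (simp add: eq degree_monom_eq)
  moreover have "(- 1 :: real) ^ r = 1"
    using P'[of "-1"] by (simp add: eq poly_monom)
  then have "even r" using minus_one_power_iff[of r, where 'a = real] by (auto split: if_splits)
  ultimately show ?thesis by simp
qed

section \<open>Sums of squares\<close>

lemma sos_polys_nonneg:
  assumes "q \<in> sos_polys d"
  shows "q x \<ge> 0"
  using assms unfolding sos_polys_def positive_semidefinite_on_def by auto

lemma sos_polys_degree:
  assumes "q \<in> sos_polys d"
  shows "poly_degree_le d q"
proof -
  obtain P where q: "q = (\<lambda>x. \<Sum>\<alpha>\<in>multi_indices (d div 2). \<Sum>\<beta>\<in>multi_indices (d div 2).
                           monomial \<alpha> x * P \<alpha> \<beta> * monomial \<beta> x)"
    using assms unfolding sos_polys_def by blast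
  have "q = (\<lambda>x. \<Sum>\<alpha>\<in>multi_indices (d div 2). \<Sum>\<beta>\<in>multi_indices (d div 2).
                           P \<alpha> \<beta> * (monomial \<alpha> x * monomial \<beta> x))"
    by (simp add: q mult_ac)
  moreover have "poly_degree_le (d div 2 + d div 2) \<dots>"
    by (intro poly_degree_le_sum poly_degree_le_cmult poly_degree_le_mult poly_degree_le_monomial)
  ultimately have "poly_degree_le (d div 2 + d div 2) q" by (simp only:)
  then show ?thesis
    by (rule poly_degree_le_mono) simp
qed

lemma sos_polys_zero: "(\<lambda>x. 0) \<in> sos_polys d"
  unfolding sos_polys_def
  by (auto intro!: exI[of _ "\<lambda>_ _. 0"] simp: positive_semidefinite_on_def)

lemma sos_polys_add:
  assumes "q1 \<in> sos_polys d" and "q2 \<in> sos_polys d"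
  shows "(\<lambda>x. q1 x + q2 x) \<in> sos_polys d"
proof -
  let ?I = "multi_indices (d div 2)"
  obtain P1 P2 where P: "positive_semidefinite_on ?I P1" "positive_semidefinite_on ?I P2"
    and q: "\<And>x. q1 x = (\<Sum>\<alpha>\<in>?I. \<Sum>\<beta>\<in>?I. monomial \<alpha> x * P1 \<alpha> \<beta> * monomial \<beta> x)"
           "\<And>x. q2 x = (\<Sum>\<alpha>\<in>?I. \<Sum>\<beta>\<in>?I. monomial \<alpha> x * P2 \<alpha> \<beta> * monomial \<beta> x)"
    using assms unfolding sos_polys_def by blast
  let ?P = "\<lambda>\<alpha> \<beta>. P1 \<alpha> \<beta> + P2 \<alpha> \<beta>"
  have "positive_semidefinite_on ?I ?P"
    using P unfolding positive_semidefinite_on_def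
    by (simp add: distrib_left distrib_right sum.distrib)
  moreover have "q1 x + q2 x = (\<Sum>\<alpha>\<in>?I. \<Sum>\<beta>\<in>?I. monomial \<alpha> x * ?P \<alpha> \<beta> * monomial \<beta> x)" for x
    by (simp add: q distrib_left distrib_right sum.distrib)
  ultimately show ?thesis
    unfolding sos_polys_def mem_Collect_eq by (intro exI[of _ ?P] conjI allI)
qed

lemma sos_polys_cmult:
  assumes "q \<in> sos_polys d" and "a \<ge> 0"
  shows "(\<lambda>x. a * q x) \<in> sos_polys d"
proof -
  let ?I = "multi_indices (d div 2)"
  obtain P where P: "positive_semidefinite_on ?I P"
    and q: "\<And>x. q x = (\<Sum>\<alpha>\<in>?I. \<Sum>\<beta>\<in>?I. monomial \<alpha> x * P \<alpha> \<beta> * monomial \<beta> x)"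
    using assms unfolding sos_polys_def by blast
  let ?P = "\<lambda>\<alpha> \<beta>. a * P \<alpha> \<beta>"
  have factor: "(\<Sum>\<alpha>\<in>?I. \<Sum>\<beta>\<in>?I. v \<alpha> * ?P \<alpha> \<beta> * v \<beta>)
      = a * (\<Sum>\<alpha>\<in>?I. \<Sum>\<beta>\<in>?I. v \<alpha> * P \<alpha> \<beta> * v \<beta>)" for v
    by (simp add: sum_distrib_left mult_ac)
  have "positive_semidefinite_on ?I ?P"
    using P assms(2) unfolding positive_semidefinite_on_def factor by simp
  moreover have "a * q x = (\<Sum>\<alpha>\<in>?I. \<Sum>\<beta>\<in>?I. monomial \<alpha> x * ?P \<alpha> \<beta> * monomial \<beta> x)" for x
    unfolding factor q ..
  ultimately show ?thesis
    unfolding sos_polys_def mem_Collect_eq by (intro exI[of _ ?P] conjI allI)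
qed

lemma sos_polys_sum:
  assumes "\<And>i. i \<in> I \<Longrightarrow> q i \<in> sos_polys d"
  shows "(\<lambda>x. \<Sum>i\<in>I. q i x) \<in> sos_polys d"
  using assms
  by (induction I rule: infinite_finite_induct) (auto intro: sos_polys_zero sos_polys_add)

text \<open>The Gram matrix of a single square is the rank-one matrix of the coefficients.\<close>

lemma sos_polys_square:
  assumes "poly_degree_le e q" and "2 * e \<le> d"
  shows "(\<lambda>x. (q x)\<^sup>2) \<in> sos_polys d"
proof -
  let ?I = "multi_indices (d div 2)"
  have "poly_degree_le (d div 2) q"
    using assms by (auto intro: poly_degree_le_mono)
  then obtain c where q: "\<And>x. q x = (\<Sum>\<alpha>\<in>?I. c \<alpha> * monomial \<alpha> x)"
    unfolding poly_degree_le_def by blast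
  let ?P = "\<lambda>\<alpha> \<beta>. c \<alpha> * c \<beta>"
  have square: "(\<Sum>\<alpha>\<in>?I. \<Sum>\<beta>\<in>?I. v \<alpha> * ?P \<alpha> \<beta> * v \<beta>) = (\<Sum>\<alpha>\<in>?I. c \<alpha> * v \<alpha>)\<^sup>2" for v
    by (simp add: power2_eq_square sum_product mult_ac)
  have "positive_semidefinite_on ?I ?P"
    unfolding positive_semidefinite_on_def square by simp
  moreover have "(q x)\<^sup>2 = (\<Sum>\<alpha>\<in>?I. \<Sum>\<beta>\<in>?I. monomial \<alpha> x * ?P \<alpha> \<beta> * monomial \<beta> x)" for x
    unfolding square q ..
  ultimately show ?thesis
    unfolding sos_polys_def mem_Collect_eq by (intro exI[of _ ?P] conjI allI)
qed

text \<open>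
  For \<open>r\<close> divisible by \<open>4\<close> the norm power is the square of \<open>(x \<bullet> x)\<^sup>l\<close> with \<open>l = r / 4\<close>. Otherwise one
  factor \<open>x \<bullet> x\<close> is left over, and it is distributed as the sum of the squared coordinates.
\<close>

lemma sos_polys_norm_power:
  assumes "even r" and "r \<le> d"
  shows "(\<lambda>x :: real ^ 'n::finite. norm x ^ r) \<in> sos_polys d"
proof -
  obtain j where r: "r = 2 * j" using assms(1) by (elim evenE)
  have norm: "norm x ^ r = (x \<bullet> x) ^ j" for x :: "real ^ 'n"
    by (simp add: r power_mult dot_square_norm)
  show ?thesis
  proof (cases "even j")
    case True
    then obtain l where j: "j = 2 * l" by (elim evenE)
    have "poly_degree_le (2 * l) (\<lambda>x :: real ^ 'n. (x \<bullet> x) ^ l)"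
      by (rule poly_degree_le_power[OF poly_degree_le_inner_self])
    then have "(\<lambda>x :: real ^ 'n. ((x \<bullet> x) ^ l)\<^sup>2) \<in> sos_polys d"
      using assms(2) r j by (intro sos_polys_square) auto
    then show ?thesis
      by (simp add: norm j power_mult[symmetric] mult.commute)
  next
    case False
    then obtain l where j: "j = 2 * l + 1" by (elim oddE)
    have "poly_degree_le (1 + 2 * l) (\<lambda>x :: real ^ 'n. x $ i * (x \<bullet> x) ^ l)" for i
      by (intro poly_degree_le_mult poly_degree_le_coordinate
            poly_degree_le_power[OF poly_degree_le_inner_self])
    then have "(\<lambda>x :: real ^ 'n. \<Sum>i\<in>UNIV. (x $ i * (x \<bullet> x) ^ l)\<^sup>2) \<in> sos_polys d"
      using assms(2) r j by (intro sos_polys_sum sos_polys_square) auto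
    moreover have "(\<Sum>i\<in>UNIV. (x $ i * (x \<bullet> x) ^ l)\<^sup>2) = norm x ^ r" for x :: "real ^ 'n"
    proof -
      have "(\<Sum>i\<in>UNIV. (x $ i * (x \<bullet> x) ^ l)\<^sup>2) = (x \<bullet> x) * ((x \<bullet> x) ^ l)\<^sup>2"
        by (simp add: power_mult_distrib inner_self_vec[of x] sum_distrib_right)
      also have "\<dots> = norm x ^ r"
        by (simp add: norm j power_mult[symmetric] mult.commute)
      finally show ?thesis .
    qed
    ultimately show ?thesis by simp
  qed
qed

section \<open>Sums of squares relative to a semialgebraic set\<close>

text \<open>The easy half of a Positivstellensatz: certificates are sound.\<close>

lemma sos_polys_on_nonneg:
  assumes "q \<in> sos_polys_on m g dg d" and "x \<in> semialgebraic_set m g"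
  shows "q x \<ge> 0"
proof -
  obtain s0 s where s: "s0 \<in> sos_polys d"
    "\<And>i. i < m \<Longrightarrow> if dg i \<le> d then s i \<in> sos_polys (d - dg i) else s i = (\<lambda>x. 0)"
    and q: "q x = s0 x + (\<Sum>i<m. s i x * g i x)"
    using assms(1) unfolding sos_polys_on_def by blast
  have "s i x \<ge> 0" if "i < m" for i
    using s(2)[OF that] by (auto simp: sos_polys_nonneg split: if_splits)
  moreover have "g i x \<ge> 0" if "i < m" for i
    using assms(2) that by (simp add: semialgebraic_set_def)
  ultimately have "(\<Sum>i<m. s i x * g i x) \<ge> 0"
    by (intro sum_nonneg mult_nonneg_nonneg) auto
  then show ?thesis
    using sos_polys_nonneg[OF s(1)] by (simp add: q)
qed

text \<open>
  The degree bounds on the multipliers are what keeps a certificate from representing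
  polynomials of higher degree.
\<close>

lemma sos_polys_on_degree:
  assumes "q \<in> sos_polys_on m g dg d" and "\<And>i. i < m \<Longrightarrow> poly_degree_le (dg i) (g i)"
  shows "poly_degree_le d q"
proof -
  obtain s0 s where s: "s0 \<in> sos_polys d"
    "\<And>i. i < m \<Longrightarrow> if dg i \<le> d then s i \<in> sos_polys (d - dg i) else s i = (\<lambda>x. 0)"
    and q: "q = (\<lambda>x. s0 x + (\<Sum>i<m. s i x * g i x))"
    using assms(1) unfolding sos_polys_on_def by blast
  have "poly_degree_le d (\<lambda>x. s i x * g i x)" if "i < m" for i
  proof (cases "dg i \<le> d")
    case True
    then have "poly_degree_le (d - dg i + dg i) (\<lambda>x. s i x * g i x)"
      using s(2)[OF that] by (intro poly_degree_le_mult sos_polys_degree assms(2) that) simp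
    then show ?thesis using True by simp
  next
    case False
    then show ?thesis using s(2)[OF that] by (simp add: poly_degree_le_zero)
  qed
  then show ?thesis
    unfolding q by (intro poly_degree_le_add poly_degree_le_sum sos_polys_degree[OF s(1)]) simp
qed

lemma sos_polys_subset_sos_polys_on: 
  fixes g :: "nat \<Rightarrow> real ^ 'n::finite \<Rightarrow> real"
  shows "sos_polys d \<subseteq> sos_polys_on m g dg d"
proof
  fix q :: "real ^ 'n \<Rightarrow> real"
  assume "q \<in> sos_polys d"
  then show "q \<in> sos_polys_on m g dg d"
    unfolding sos_polys_on_def
    by (auto intro!: exI[of _ q] exI[of _ "\<lambda>_ _. 0"] simp: sos_polys_zero)
qed

lemma sos_polys_on_add:
  assumes "q1 \<in> sos_polys_on m g dg d" and "q2 \<in> sos_polys_on m g dg d"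
  shows "(\<lambda>x. q1 x + q2 x) \<in> sos_polys_on m g dg d"
proof -
  obtain s0 s where s: "s0 \<in> sos_polys d"
    "\<And>i. i < m \<Longrightarrow> if dg i \<le> d then s i \<in> sos_polys (d - dg i) else s i = (\<lambda>x. 0)"
    "\<And>x. q1 x = s0 x + (\<Sum>i<m. s i x * g i x)"
    using assms(1) unfolding sos_polys_on_def by blast
  obtain s0' s' where s': "s0' \<in> sos_polys d"
    "\<And>i. i < m \<Longrightarrow> if dg i \<le> d then s' i \<in> sos_polys (d - dg i) else s' i = (\<lambda>x. 0)"
    "\<And>x. q2 x = s0' x + (\<Sum>i<m. s' i x * g i x)"
    using assms(2) unfolding sos_polys_on_def by blast
  have "if dg i \<le> d then (\<lambda>x. s i x + s' i x) \<in> sos_polys (d - dg i)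
        else (\<lambda>x. s i x + s' i x) = (\<lambda>x. 0)" if "i < m" for i
    using s(2)[OF that] s'(2)[OF that] by (simp add: sos_polys_add split: if_splits)
  moreover have "q1 x + q2 x = (s0 x + s0' x) + (\<Sum>i<m. (s i x + s' i x) * g i x)" for x
    by (simp add: s(3) s'(3) distrib_right sum.distrib)
  moreover have "(\<lambda>x. s0 x + s0' x) \<in> sos_polys d"
    by (rule sos_polys_add[OF s(1) s'(1)])
  ultimately show ?thesis
    unfolding sos_polys_on_def mem_Collect_eq
    by (intro exI[of _ "\<lambda>x. s0 x + s0' x"] exI[of _ "\<lambda>i x. s i x + s' i x"]) blast
qed

lemma sos_polys_on_cmult:
  assumes "q \<in> sos_polys_on m g dg d" and "a \<ge> 0"
  shows "(\<lambda>x. a * q x) \<in> sos_polys_on m g dg d"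
proof -
  obtain s0 s where s: "s0 \<in> sos_polys d"
    "\<And>i. i < m \<Longrightarrow> if dg i \<le> d then s i \<in> sos_polys (d - dg i) else s i = (\<lambda>x. 0)"
    "\<And>x. q x = s0 x + (\<Sum>i<m. s i x * g i x)"
    using assms(1) unfolding sos_polys_on_def by blast
  have "if dg i \<le> d then (\<lambda>x. a * s i x) \<in> sos_polys (d - dg i)
        else (\<lambda>x. a * s i x) = (\<lambda>x. 0)" if "i < m" for i
    using s(2)[OF that] assms(2) by (simp add: sos_polys_cmult split: if_splits)
  moreover have "a * q x = a * s0 x + (\<Sum>i<m. a * s i x * g i x)" for x
    by (simp add: s(3) distrib_left sum_distrib_left mult_ac)
  moreover have "(\<lambda>x. a * s0 x) \<in> sos_polys d"
    by (rule sos_polys_cmult[OF s(1) assms(2)])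
  ultimately show ?thesis
    unfolding sos_polys_on_def mem_Collect_eq
    by (intro exI[of _ "\<lambda>x. a * s0 x"] exI[of _ "\<lambda>i x. a * s i x"]) blast
qed

section \<open>The gain of an optimal solution\<close>

lemma inner_self_powr_half:
  assumes "r > 0"
  shows "(x \<bullet> x) powr (real r / 2) = norm x ^ r"
proof (cases "x = 0")
  case False
  have "(x \<bullet> x) powr (real r / 2) = (norm x powr 2) powr (real r / 2)"
    using False by (simp add: dot_square_norm powr_realpow[of _ 2, simplified])
  also have "\<dots> = norm x powr real r" by (simp only: powr_powr) simp
  also have "\<dots> = norm x ^ r"
    using False by (simp add: powr_realpow)
  finally show ?thesis .
qed (use assms in simp)

text \<open>
  The constraints alone do not bound \<open>\<gamma>\<close> from below when \<open>\<Omega>\<close> has no nonzero point. The contradiction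
  comes from optimality: a gain below \<open>1\<close> would place both \<open>\<bar>x\<bar>\<^sup>r\<close> and \<open>- \<bar>x\<bar>\<^sup>r\<close> in the cone, so that
  \<open>V = 0\<close> satisfies all constraints with a larger \<open>k\<close>.
\<close>

lemma solves_optimization_gain_ge_1:
  fixes f :: "real ^ 'n::finite \<Rightarrow> real ^ 'n"
  assumes r: "r > 0" and g: "\<And>i. i < m \<Longrightarrow> poly_degree_le (dg i) (g i)"
    and opt: "solves_optimization r d p df f m g dg k \<gamma> V"
  shows "\<gamma> \<ge> 1"
proof (rule ccontr)
  assume "\<not> \<gamma> \<ge> 1"
  then have \<gamma>: "\<gamma> < 1" by simp
  let ?S = "sos_polys_on m g dg (2 * d)"
  have feas: "feasible r d p df f m g dg (k, \<gamma>, V)"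
    and best: "\<not> feasible r d p df f m g dg (k + 1, 1, \<lambda>x. 0)"
    using opt unfolding solves_optimization_def is_arg_max_def by force+
  have "(\<lambda>x. V x - norm x ^ r) \<in> ?S" "(\<lambda>x. \<gamma> * norm x ^ r - V x) \<in> ?S"
    using feas r by (simp_all add: feasible_def inner_self_powr_half)
  from sos_polys_on_add[OF this] have "(\<lambda>x. \<gamma> * norm x ^ r - norm x ^ r) \<in> ?S"
    by simp
  then have "(\<lambda>x. 1 / (1 - \<gamma>) * (\<gamma> * norm x ^ r - norm x ^ r)) \<in> ?S"
    using \<gamma> by (intro sos_polys_on_cmult) auto
  moreover have "1 / (1 - \<gamma>) * (\<gamma> * norm x ^ r - norm x ^ r) = - (norm x ^ r)" for x :: "real ^ 'n"
    using \<gamma> by (simp add: field_simps)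
  ultimately have neg: "(\<lambda>x. - (norm x ^ r)) \<in> ?S"
    by simp
  then have "poly_degree_le (2 * d) (\<lambda>x :: real ^ 'n. norm x ^ r)"
    using poly_degree_le_cmult[OF sos_polys_on_degree[OF neg g], of "-1"] by simp
  then have "(\<lambda>x :: real ^ 'n. norm x ^ r) \<in> sos_polys (2 * d)"
    using norm_power_polynomial_imp sos_polys_norm_power by blast
  then have pos: "(\<lambda>x. norm x ^ r) \<in> ?S"
    using sos_polys_subset_sos_polys_on by blast
  have zero: "(\<lambda>x :: real ^ 'n. 0) \<in> sos_polys_on m g dg e" for e
    using sos_polys_zero sos_polys_subset_sos_polys_on by blast
  have grad: "gradient (\<lambda>x. 0) x = 0" for x :: "real ^ 'n"
    by (simp add: gradient_def vec_eq_iff)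
  have "feasible r d p df f m g dg (k + 1, 1, \<lambda>x. 0)"
    using feas neg pos zero r by (simp add: feasible_def inner_self_powr_half grad real_polynomial_function.intros)
  then show False using best by contradiction
qed

section \<open>Lyapunov functions with rational decay\<close>

lemma gradient_inner:
  fixes V :: "real ^ 'n::finite \<Rightarrow> real"
  assumes "V differentiable (at x)"
  shows "gradient V x \<bullet> v = frechet_derivative V (at x) v"
proof -
  interpret linear "frechet_derivative V (at x)"
    by (rule linear_frechet_derivative[OF assms])
  have "frechet_derivative V (at x) v = frechet_derivative V (at x) (\<Sum>i\<in>UNIV. v $ i *\<^sub>R axis i 1)"
    using basis_expansion[of v] by (simp add: scalar_mult_eq_scaleR)
  also have "\<dots> = gradient V x \<bullet> v"
    by (simp add: sum scaleR gradient_def inner_vec_def mult.commute)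
  finally show ?thesis ..
qed

lemma DERIV_along_solution:
  assumes V: "\<And>x. V differentiable (at x)"
    and y: "solves_ivp f x y" and "t > 0"
  shows "((\<lambda>s. V (y s)) has_real_derivative gradient V (y t) \<bullet> f (y t)) (at t)"
proof -
  have "(y has_vector_derivative f (y t)) (at t within {0..})"
    using y \<open>t > 0\<close> by (simp add: solves_ivp_def)
  then have "(y has_vector_derivative f (y t)) (at t)"
    using \<open>t > 0\<close> at_within_interior[of t "{0..}"] by simp
  then have "(y has_derivative (\<lambda>h. h *\<^sub>R f (y t))) (at t)"
    by (simp add: has_vector_derivative_def)
  moreover have "(V has_derivative frechet_derivative V (at (y t))) (at (y t))"
    using V frechet_derivative_works by blast
  ultimately have "((\<lambda>s. V (y s)) has_derivative (\<lambda>h. frechet_derivative V (at (y t)) (h *\<^sub>R f (y t)))) (at t)"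
    by (rule has_derivative_compose)
  moreover have "frechet_derivative V (at (y t)) (h *\<^sub>R f (y t)) = (gradient V (y t) \<bullet> f (y t)) * h" for h
    by (simp add: gradient_inner[OF V, symmetric])
  ultimately show ?thesis
    by (simp add: has_field_derivative_def)
qed

lemma solves_ivp_continuous:
  assumes "solves_ivp f x y"
  shows "continuous_on {0..} y"
proof (rule continuous_on_vector_derivative)
  fix t :: real
  assume "t \<in> {0..}"
  then show "(y has_vector_derivative f (y t)) (at t within {0..})"
    using assms by (simp add: solves_ivp_def)
qed

text \<open>
  A solution that is outside the sublevel set at time \<open>t\<close> has a last time \<open>T\<close> in it. At time \<open>T\<close> it is
  still in the interior of \<open>\<Omega>\<close>, so it stays in \<open>\<Omega>\<close> for a short time after \<open>T\<close>. There \<open>V\<close> does not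
  increase, so \<open>T\<close> was not the last time.
\<close>

lemma sublevel_set_invariant:
  assumes V: "\<And>x. V differentiable (at x)"
    and y: "solves_ivp f x y"
    and sub: "sublevel_set V c \<subseteq> interior \<Omega>"
    and decr: "\<And>z. z \<in> \<Omega> \<Longrightarrow> gradient V z \<bullet> f z \<le> 0"
    and x: "x \<in> sublevel_set V c" and "t \<ge> 0"
  shows "y t \<in> sublevel_set V c"
proof (rule ccontr)
  define W where "W = (\<lambda>s. V (y s))"
  assume "y t \<notin> sublevel_set V c"
  then have Wt: "W t > c" by (simp add: W_def sublevel_set_def)
  have cont_V: "continuous_on UNIV V"
    using V differentiable_imp_continuous_within continuous_at_imp_continuous_on by blast
  have cont_y: "continuous_on {0..t} y"
    using solves_ivp_continuous[OF y] by (rule continuous_on_subset) auto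
  have cont_W: "continuous_on {0..t} W"
    unfolding W_def using cont_V cont_y
    by (rule continuous_on_compose2) auto
  define A where "A = {s \<in> {0..t}. W s \<le> c}"
  have "compact A"
    unfolding compact_eq_bounded_closed A_def
  proof
    show "bounded {s \<in> {0..t}. W s \<le> c}" by (rule bounded_subset[of "{0..t}"]) auto
    show "closed {s \<in> {0..t}. W s \<le> c}"
      using continuous_closed_preimage[OF cont_W, of "{..c}"] by (simp add: vimage_def Int_def)
  qed
  moreover have "0 \<in> A"
    using x y \<open>t \<ge> 0\<close> by (simp add: A_def W_def sublevel_set_def solves_ivp_def)
  ultimately obtain T where T: "T \<in> A" and last: "\<And>s. s \<in> A \<Longrightarrow> s \<le> T"
    using compact_attains_sup[of A] by blast
  have "T < t" using T Wt by (auto simp: A_def less_le)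
  have "T \<ge> 0" using T by (simp add: A_def)
  have "y T \<in> interior \<Omega>" using T sub by (auto simp: A_def W_def sublevel_set_def)
  moreover have "(y \<longlongrightarrow> y T) (at T within {0..t})"
    using cont_y \<open>T < t\<close> \<open>T \<ge> 0\<close> by (simp add: continuous_on_def)
  ultimately have "eventually (\<lambda>s. y s \<in> interior \<Omega>) (at T within {0..t})"
    by (intro topological_tendstoD) auto
  then obtain \<delta> where \<delta>: "\<delta> > 0"
    and near: "\<And>s. s \<in> {0..t} \<Longrightarrow> s \<noteq> T \<Longrightarrow> dist s T < \<delta> \<Longrightarrow> y s \<in> interior \<Omega>"
    unfolding eventually_at by auto
  \<comment> \<open>Half of \<open>\<delta>\<close> stays strictly inside the neighbourhood; the minimum keeps \<open>T'\<close> in the time interval.\<close>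
  define T' where "T' = min t (T + \<delta> / 2)"
  have T': "T < T'" "T' \<le> t" "T' < T + \<delta>"
    using \<open>T < t\<close> \<delta> by (auto simp: T'_def)
  have "W T' \<le> W T"
  proof -
    have "- W T \<le> - W T'"
    proof (rule DERIV_nonneg_imp_increasing_open[where f = "\<lambda>s. - W s"])
      fix s assume s: "T < s" "s < T'"
      then have "y s \<in> \<Omega>"
        using near[of s] T' \<open>T \<ge> 0\<close> interior_subset by (force simp: dist_real_def)
      moreover have "((\<lambda>s. - W s) has_real_derivative - (gradient V (y s) \<bullet> f (y s))) (at s)"
        unfolding W_def using DERIV_along_solution[OF V y] s \<open>T \<ge> 0\<close> by (intro DERIV_minus) auto
      ultimately show "\<exists>D. ((\<lambda>s. - W s) has_real_derivative D) (at s) \<and> 0 \<le> D"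
        using decr by fastforce
    qed (use T' \<open>T \<ge> 0\<close> in \<open>auto intro!: continuous_on_minus continuous_on_subset[OF cont_W]\<close>)
    then show ?thesis by simp
  qed
  then have "T' \<in> A" using T T' by (simp add: A_def)
  then show False using last T' by fastforce
qed

text \<open>
  Bernoulli's substitution: the differential inequality says that \<open>W\<^sup>-\<^sup>a\<close> has derivative at
  least \<open>b\<close>, and integrating this gives the reciprocal of the claim.
\<close>

lemma rational_decay:
  fixes W :: "real \<Rightarrow> real"
  assumes "a > 0" and "b \<ge> 0" and "T \<ge> 0"
    and cont: "continuous_on {0..T} W"
    and pos: "\<And>s. 0 \<le> s \<Longrightarrow> s \<le> T \<Longrightarrow> W s > 0"
    and deriv: "\<And>s. 0 < s \<Longrightarrow> s < T \<Longrightarrow> (W has_real_derivative D s) (at s)"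
    and bound: "\<And>s. 0 < s \<Longrightarrow> s < T \<Longrightarrow> D s \<le> - (b / a) * W s powr (1 + a)"
  shows "W T powr a \<le> W 0 powr a / (1 + W 0 powr a * b * T)"
proof -
  define U where "U = (\<lambda>s. W s powr (- a) - b * s)"
  have "U 0 \<le> U T"
  proof (rule DERIV_nonneg_imp_increasing_open[where f = U])
    fix s assume s: "0 < s" "s < T"
    then have Ws: "W s > 0" using pos by simp
    have "(U has_real_derivative - a * W s powr (- a - 1) * D s - b) (at s)"
    proof -
      have "((\<lambda>u. W u powr (- a)) has_real_derivative - a * W s powr (- a - 1) * D s) (at s)"
        using DERIV_fun_powr[OF deriv[OF s] Ws, of "- a"] by simp
      moreover have "((\<lambda>u. b * u) has_real_derivative b) (at s)"
        by (auto intro!: derivative_eq_intros)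
      ultimately show ?thesis unfolding U_def by (rule DERIV_diff)
    qed
    moreover have "- a * W s powr (- a - 1) * D s \<ge> b"
    proof -
      have "- a * W s powr (- a - 1) * D s \<ge> - a * W s powr (- a - 1) * (- (b / a) * W s powr (1 + a))"
        using bound[OF s] \<open>a > 0\<close> by (intro mult_left_mono_neg) auto
      also have "- a * W s powr (- a - 1) * (- (b / a) * W s powr (1 + a))
          = b * W s powr ((- a - 1) + (1 + a))"
        unfolding powr_add[of "W s" "- a - 1" "1 + a"] using \<open>a > 0\<close> by simp
      also have "\<dots> = b" using Ws by simp
      finally show ?thesis .
    qed
    ultimately show "\<exists>y. (U has_real_derivative y) (at s) \<and> 0 \<le> y" by force
  next
    show "continuous_on {0..T} U"
      unfolding U_def using pos by (intro continuous_intros cont) force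
  qed fact
  then have le: "W 0 powr (- a) + b * T \<le> W T powr (- a)" by (simp add: U_def)
  have W0: "W 0 powr a > 0" and WT: "W T powr a > 0"
    using pos[of 0] pos[of T] \<open>T \<ge> 0\<close> by auto
  have "(1 + W 0 powr a * b * T) / W 0 powr a \<le> 1 / W T powr a"
    using le W0 by (simp add: powr_minus_divide add_divide_distrib)
  then have "W T powr a * (1 + W 0 powr a * b * T) \<le> W 0 powr a"
    using W0 WT by (simp add: field_simps)
  moreover have "1 + W 0 powr a * b * T > 0"
    using W0 \<open>b \<ge> 0\<close> \<open>T \<ge> 0\<close> by (simp add: add_pos_nonneg)
  ultimately show ?thesis by (simp add: pos_le_divide_eq)
qed

text \<open>
  The map \<open>u \<mapsto> u / (1 + u s)\<close> is increasing; this allows the initial value of \<open>V\<close> in the decay estimate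
  to be replaced by its upper bound.
\<close>

lemma rational_bound_mono:
  fixes u v s :: real
  assumes "0 \<le> u" and "u \<le> v" and "s \<ge> 0"
  shows "u / (1 + u * s) \<le> v / (1 + v * s)"
proof -
  have "1 + u * s > 0" "1 + v * s > 0"
    using assms by (simp_all add: add_pos_nonneg)
  then show ?thesis
    using assms by (simp add: divide_simps distrib_left mult_ac)
qed

text \<open>
  The power \<open>a = p / r\<close> turns \<open>\<bar>x\<bar>\<^sup>r\<close> into \<open>\<bar>x\<bar>\<^sup>p\<close>, so it converts between the scale of \<open>V\<close> and that of
  the claim. The factor \<open>\<gamma>\<^sup>a\<close> that is lost in the rate \<open>b\<close> is regained
  from the bound on the initial value: the two cancel in the denominator and the rate is exactly \<open>k\<close>.
\<close>

lemma lyapunov_rational_stability: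
  fixes \<Omega> :: "(real ^ 'n::finite) set"
  assumes "r > 0" and "p > 0" and k: "k \<ge> 0" and \<gamma>: "\<gamma> > 0"
    and V: "\<And>x. V differentiable (at x)"
    and lower: "\<And>x. x \<in> \<Omega> \<Longrightarrow> norm x ^ r \<le> V x"
    and upper: "\<And>x. x \<in> \<Omega> \<Longrightarrow> V x \<le> \<gamma> * norm x ^ r"
    and decr: "\<And>x. x \<in> \<Omega> \<Longrightarrow> gradient V x \<bullet> f x \<le> - (k * real r / real p) * V x * norm x ^ p"
    and sub: "sublevel_set V c \<subseteq> interior \<Omega>"
    and y: "solves_ivp f x y" and x: "x \<in> sublevel_set V c" and t: "t \<ge> 0"
  shows "norm (y t) ^ p \<le> \<gamma> powr (real p / real r) * (norm x ^ p / (1 + norm x ^ p * k * t))"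
proof -
  define W where "W = (\<lambda>s. V (y s))"
  define a where "a = real p / real r"
  have a: "a > 0" using assms(1,2) by (simp add: a_def)
  have root: "(norm z ^ r) powr a = norm z ^ p" for z :: "real ^ 'n"
  proof (cases "z = 0")
    case False
    then have "(norm z ^ r) powr a = norm z powr (real r * a)"
      by (simp add: powr_realpow[symmetric] powr_powr)
    also have "\<dots> = norm z ^ p"
      using False assms(1) by (simp add: a_def powr_realpow)
    finally show ?thesis .
  qed (use assms(1,2) in \<open>simp add: power_0_left\<close>)
  have V_nonneg: "V z \<ge> 0" if "z \<in> \<Omega>" for z
    by (rule order.trans[OF _ lower[OF that]]) simp
  have decr0: "gradient V z \<bullet> f z \<le> 0" if "z \<in> \<Omega>" for z
  proof -
    have "(k * real r / real p) * V z * norm z ^ p \<ge> 0"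
      using k V_nonneg[OF that] by simp
    then show ?thesis using decr[OF that] by simp
  qed
  have y\<Omega>: "y s \<in> \<Omega>" if "s \<ge> 0" for s
    using sublevel_set_invariant[OF V y sub decr0 x that] sub interior_subset by blast
  have y0: "y 0 = x" using y by (simp add: solves_ivp_def)
  have cont: "continuous_on {0..s} W" for s
  proof -
    have "continuous_on UNIV V"
      using V differentiable_imp_continuous_within continuous_at_imp_continuous_on by blast
    moreover have "continuous_on {0..s} y"
      using solves_ivp_continuous[OF y] by (rule continuous_on_subset) auto
    ultimately show ?thesis unfolding W_def by (rule continuous_on_compose2) auto
  qed
  have deriv: "(W has_real_derivative gradient V (y s) \<bullet> f (y s)) (at s)" if "s > 0" for s
    unfolding W_def by (rule DERIV_along_solution[OF V y that])
  show ?thesis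
  proof (cases "W t = 0")
    \<comment> \<open>The negative power of \<open>W\<close> needs \<open>W > 0\<close> on all of \<open>[0, t]\<close>; otherwise the solution has reached \<open>0\<close>.\<close>
    case True
    then have "norm (y t) ^ r \<le> 0" using lower[OF y\<Omega>[OF t]] by (simp add: W_def)
    then have "y t = 0" using assms(1) by (auto simp: power_le_zero_eq)
    then show ?thesis
      using assms(2) k t by (simp add: power_0_left)
  next
    case False
    then have Wt: "W t > 0" using V_nonneg[OF y\<Omega>[OF t]] by (simp add: W_def less_le)
    have pos: "W s > 0" if s: "0 \<le> s" "s \<le> t" for s
    proof -
      have "- W s \<le> - W t"
      proof (rule DERIV_nonneg_imp_increasing_open[where f = "\<lambda>u. - W u", OF s(2)])
        fix u assume u: "s < u" "u < t"
        then show "\<exists>D. ((\<lambda>u. - W u) has_real_derivative D) (at u) \<and> 0 \<le> D"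
          using DERIV_minus[OF deriv[of u]] decr0[OF y\<Omega>[of u]] s(1) by force
      qed (use s in \<open>auto intro!: continuous_on_minus continuous_on_subset[OF cont[of t]]\<close>)
      then show ?thesis using Wt by simp
    qed
    define b where "b = k / \<gamma> powr a"
    have b: "b \<ge> 0" using k by (simp add: b_def)
    have "W t powr a \<le> W 0 powr a / (1 + W 0 powr a * (b * t))"
      unfolding mult.assoc[symmetric]
    proof (rule rational_decay[OF a b t cont pos deriv])
      fix s assume s: "0 < s" "s < t"
      have Ws: "W s > 0" using pos s by simp
      have "W s powr a \<le> (\<gamma> * norm (y s) ^ r) powr a"
        using upper[OF y\<Omega>[of s]] s Ws a by (intro powr_mono2) (auto simp: W_def)
      also have "\<dots> = \<gamma> powr a * norm (y s) ^ p"
        using \<gamma> by (simp add: powr_mult root)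
      finally have "W s powr a / \<gamma> powr a \<le> norm (y s) ^ p"
        using \<gamma> by (simp add: divide_le_eq mult.commute)
      then have "(k / a * W s) * (W s powr a / \<gamma> powr a) \<le> (k / a * W s) * norm (y s) ^ p"
        using k a Ws by (intro mult_left_mono) auto
      moreover have "W s powr (1 + a) = W s * W s powr a"
        using Ws by (simp add: powr_add)
      ultimately have "b / a * W s powr (1 + a) \<le> (k * real r / real p) * W s * norm (y s) ^ p"
        by (simp add: b_def a_def mult_ac)
      then show "gradient V (y s) \<bullet> f (y s) \<le> - (b / a) * W s powr (1 + a)"
        using decr[OF y\<Omega>[of s]] s by (simp add: W_def)
    qed
    moreover have "norm (y t) ^ p \<le> W t powr a"
      unfolding root[symmetric] using lower[OF y\<Omega>[OF t]] a by (intro powr_mono2) (auto simp: W_def)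
    moreover have "W 0 powr a / (1 + W 0 powr a * (b * t))
        \<le> \<gamma> powr a * norm x ^ p / (1 + \<gamma> powr a * norm x ^ p * (b * t))"
    proof (rule rational_bound_mono)
      have "W 0 powr a \<le> (\<gamma> * norm x ^ r) powr a"
        using upper[OF y\<Omega>[of 0]] pos[of 0] t a by (intro powr_mono2) (auto simp: W_def y0)
      then show "W 0 powr a \<le> \<gamma> powr a * norm x ^ p"
        using \<gamma> by (simp add: powr_mult root)
    qed (use b t in auto)
    ultimately have "norm (y t) ^ p
        \<le> \<gamma> powr a * norm x ^ p / (1 + \<gamma> powr a * norm x ^ p * (b * t))"
      by linarith
    also have "\<gamma> powr a * norm x ^ p * (b * t) = norm x ^ p * k * t"
      using \<gamma> by (simp add: b_def)
    finally show ?thesis by (simp add: a_def)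
  qed
qed

theorem corollary27:
  fixes r d p df m :: nat
    and f :: "real ^ 'n::finite \<Rightarrow> real ^ 'n"
    and \<phi> :: "real ^ 'n \<Rightarrow> real \<Rightarrow> real ^ 'n"
    and g :: "nat \<Rightarrow> real ^ 'n \<Rightarrow> real"
    and dg :: "nat \<Rightarrow> nat"
    and V :: "real ^ 'n \<Rightarrow> real"
    and k \<gamma> c :: real
  assumes "r > 0" and "p > 0"
    and "\<And>i. poly_degree_le df (\<lambda>x. f x $ i)"
    and "is_solution_map f \<phi>"
    and "\<And>i. i < m \<Longrightarrow> poly_degree_le (dg i) (g i)"
    and "solves_optimization r d p df f m g dg k \<gamma> V"
    and "c \<ge> 0"
    and "sublevel_set V c \<subseteq> interior (semialgebraic_set m g)"
  shows "rationally_stable p \<phi> (sublevel_set V c) k (\<gamma> powr (real p / real r))"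
proof -
  let ?\<Omega> = "semialgebraic_set m g"
  have "feasible r d p df f m g dg (k, \<gamma>, V)"
    using assms(6) by (simp add: solves_optimization_def is_arg_max_def)
  then have k: "k \<ge> 0" and \<gamma>: "\<gamma> > 0" and poly: "real_polynomial_function V"
    and lower: "(\<lambda>x. V x - norm x ^ r) \<in> sos_polys_on m g dg (2 * d)"
    and upper: "(\<lambda>x. \<gamma> * norm x ^ r - V x) \<in> sos_polys_on m g dg (2 * d)"
    and decr: "(\<lambda>x. - (k * real r / real p) * V x * norm x ^ p - gradient V x \<bullet> f x)
      \<in> sos_polys_on m g dg (max (2 * d + p) (2 * d + df - 1))"
    using assms(1,2) by (simp_all add: feasible_def inner_self_powr_half)
  have "\<gamma> powr (real p / real r) \<ge> 1"
    using solves_optimization_gain_ge_1[OF assms(1,5,6)] by (simp add: ge_one_powr_ge_zero)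
  moreover have "norm (\<phi> x t) ^ p
      \<le> \<gamma> powr (real p / real r) * (norm x ^ p / (1 + norm x ^ p * k * t))"
    if "x \<in> sublevel_set V c" and "t \<ge> 0" for x t
  proof (rule lyapunov_rational_stability[OF assms(1,2) k \<gamma> _ _ _ _ assms(8) _ that])
    show "V differentiable (at z)" for z
      by (rule differentiable_at_real_polynomial_function[OF poly])
    show "norm z ^ r \<le> V z" if "z \<in> ?\<Omega>" for z
      using sos_polys_on_nonneg[OF lower that] by simp
    show "V z \<le> \<gamma> * norm z ^ r" if "z \<in> ?\<Omega>" for z
      using sos_polys_on_nonneg[OF upper that] by simp
    show "gradient V z \<bullet> f z \<le> - (k * real r / real p) * V z * norm z ^ p" if "z \<in> ?\<Omega>" for z
      using sos_polys_on_nonneg[OF decr that] by simp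
    show "solves_ivp f x (\<phi> x)"
      using assms(4) by (simp add: is_solution_map_def)
  qed
  ultimately show ?thesis
    using k by (simp add: rationally_stable_def)
qed

end
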